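(* The sets of patterns $\{121,1322\}$, $\{112,1232\}$ and $\{112,2132\}$ are pairwise $m$-equivalent, that is, $\{121,1322\}\sim\{112,1232\}\sim\{112,2132\}$.
   Context: A (finite, reduced) multiset is $S=1^{a_1}2^{a_2}\cdots k^{a_k}$ with $k\ge 1$ and all $a_i\ge 1$, meaning that $i$ occurs with multiplicity $a_i$. A multipermutation of $S$ is a word having exactly $a_i$ occurrences of each letter $i\in[k]=\{1,\dots,k\}$ and no other letters. A word $\pi=\pi_1\cdots\pi_n$ contains a pattern (word) $\rho=\rho_1\cdots\rho_\ell$ if there are indices $i(1)<\cdots<i(\ell)$ such that for all $a,b\in[\ell]$: $\pi_{i(a)}<\pi_{i(b)}$ iff $\rho_a<\rho_b$, and $\pi_{i(a)}>\pi_{i(b)}$ iff $\rho_a>\rho_b$; otherwise $\pi$ avoids $\rho$. For a set $P$ of patterns, $\mathrm{av}(S;P)$ is the number of multipermutations of $S$ that avoid every pattern in $P$. Two sets of patterns $P,Q$ are $m$-equivalent, written here $P\sim Q$, if $\mathrm{av}(S;P)=\mathrm{av}(S;Q)$ for every multiset $S$. *)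

theory Defs
  imports "HOL-Combinatorics.Multiset_Permutations"
begin

text \<open>
  Words and patterns are lists of natural numbers, and multipermutations of \<open>S\<close> are the
  elements of \<^const>\<open>permutations_of_multiset\<close> applied to \<open>S\<close>. List positions count from 0.
\<close>

definition reduced_multiset :: "nat multiset \<Rightarrow> bool" where
  "reduced_multiset S \<longleftrightarrow> (\<exists>k\<ge>1. set_mset S = {1..k})"

definition contains :: "nat list \<Rightarrow> nat list \<Rightarrow> bool" where
  "contains \<pi> \<rho> \<longleftrightarrow>
    (\<exists>i. strict_mono_on {..<length \<rho>} i \<and> i ` {..<length \<rho>} \<subseteq> {..<length \<pi>} \<and>
      (\<forall>a<length \<rho>. \<forall>b<length \<rho>.
        (\<pi> ! i a < \<pi> ! i b \<longleftrightarrow> \<rho> ! a < \<rho> ! b) \<and>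
        (\<pi> ! i a > \<pi> ! i b \<longleftrightarrow> \<rho> ! a > \<rho> ! b)))"

definition avoids :: "nat list \<Rightarrow> nat list \<Rightarrow> bool" where
  "avoids \<pi> \<rho> \<longleftrightarrow> \<not> contains \<pi> \<rho>"

definition av :: "nat multiset \<Rightarrow> nat list set \<Rightarrow> nat" where
  "av S P = card {\<pi> \<in> permutations_of_multiset S. \<forall>\<rho>\<in>P. avoids \<pi> \<rho>}"

definition m_equivalent :: "nat list set \<Rightarrow> nat list set \<Rightarrow> bool" where
  "m_equivalent P Q \<longleftrightarrow> (\<forall>S. reduced_multiset S \<longrightarrow> av S P = av S Q)"

end

theory Submission
  imports Defs "HOL-Library.Sublist"
begin

text \<open>
  Build a word by inserting its letters in decreasing order. Let \<open>i\<close> be smaller than all letters of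
  \<open>w = u v\<close>. Avoiding 121 forces the \<open>a\<close> copies of \<open>i\<close> to form a block, giving \<open>u i\<^sup>a v\<close>; avoiding 112
  forces all copies but the first to the end, giving \<open>u i v i \<dots> i\<close>. As \<open>i\<close> can only play the
  smallest letter of a pattern, the pattern of length four restricts nothing but the gap \<open>(u, v)\<close>:
  for 1322 the word \<open>v\<close> must avoid 211, for 1232 it must avoid 121, and for 2132 there is no
  \<open>y\<close> in \<open>u\<close> with a subsequence \<open>z y\<close> of \<open>v\<close>, \<open>y < z\<close>. In all three cases, if \<open>w\<close> has \<open>d\<close>
  admissible gaps, then the \<open>d\<close> words obtained from \<open>w\<close> all have \<open>d + 1\<close> admissible gaps when
  \<open>a = 1\<close>, and have \<open>a + 1, \<dots>, a + d\<close> admissible gaps, each number once, when \<open>a \<ge> 2\<close>.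
  So the three generating trees are isomorphic.
\<close>

section \<open>Pattern containment through subsequences\<close>

definition order_iso :: "nat list \<Rightarrow> nat list \<Rightarrow> bool" where
  "order_iso \<sigma> \<rho> \<longleftrightarrow> length \<sigma> = length \<rho> \<and>
    (\<forall>a<length \<rho>. \<forall>b<length \<rho>. (\<sigma> ! a < \<sigma> ! b \<longleftrightarrow> \<rho> ! a < \<rho> ! b) \<and> (\<sigma> ! a > \<sigma> ! b \<longleftrightarrow> \<rho> ! a > \<rho> ! b))"

text \<open>Induction removes the largest position \<open>j\<close>: the earlier positions lie in
  \<open>take j w\<close>, and \<open>drop j w\<close> begins with \<open>w ! j\<close>.\<close>

lemma subseq_map_nth:
  assumes "sorted_wrt (<) js" "set js \<subseteq> {..<length w}"
  shows "subseq (map ((!) w) js) w"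
  using assms
proof (induction js arbitrary: w rule: rev_induct)
  case (snoc j js)
  have lt: "\<forall>k\<in>set js. k < j" and j: "j < length w"
    using snoc.prems by (auto simp: sorted_wrt_append)
  have "subseq (map ((!) (take j w)) js) (take j w)"
    using snoc.prems lt j by (intro snoc.IH) (auto simp: sorted_wrt_append)
  moreover have "map ((!) (take j w)) js = map ((!) w) js"
    using lt by auto
  ultimately have "subseq (map ((!) w) js @ [w ! j]) (take j w @ drop j w)"
    using j by (intro list_emb_append_mono) (auto simp: Cons_nth_drop_Suc[symmetric])
  then show ?case by simp
qed simp

lemma subseq_imp_strict_mono_nth:
  assumes "subseq \<sigma> w"
  shows "\<exists>i. strict_mono_on {..<length \<sigma>} i \<and> i ` {..<length \<sigma>} \<subseteq> {..<length w} \<and>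
    (\<forall>a<length \<sigma>. w ! i a = \<sigma> ! a)"
  using assms
proof (induction rule: list_emb.induct)
  case (list_emb_Nil ys)
  then show ?case by (auto simp: strict_mono_on_def)
next
  case (list_emb_Cons xs ys y)
  then obtain i where i: "strict_mono_on {..<length xs} i" "i ` {..<length xs} \<subseteq> {..<length ys}"
    "\<forall>a<length xs. ys ! i a = xs ! a" by blast
  then show ?case
    by (intro exI[of _ "Suc \<circ> i"]) (auto simp: strict_mono_on_def)
next
  case (list_emb_Cons2 x y xs ys)
  then obtain i where i: "strict_mono_on {..<length xs} i" "i ` {..<length xs} \<subseteq> {..<length ys}"
    "\<forall>a<length xs. ys ! i a = xs ! a" by blast
  \<comment> \<open>The matched head takes position 0, and every later position moves up by
    one.\<close>
  then show ?case using list_emb_Cons2.hyps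
    by (intro exI[of _ "case_nat 0 (Suc \<circ> i)"])
      (auto simp: strict_mono_on_def nth_Cons image_subset_iff less_Suc_eq_0_disj split: nat.splits)
qed

text \<open>Trades index maps for \<open>subseq\<close>, so that later arguments can cut words into
  pieces instead of computing with positions.\<close>

lemma contains_iff_subseq: "contains \<pi> \<rho> \<longleftrightarrow> (\<exists>\<sigma>. subseq \<sigma> \<pi> \<and> order_iso \<sigma> \<rho>)"
proof
  assume "contains \<pi> \<rho>"
  then obtain i where i: "strict_mono_on {..<length \<rho>} i" "i ` {..<length \<rho>} \<subseteq> {..<length \<pi>}"
    "\<forall>a<length \<rho>. \<forall>b<length \<rho>. (\<pi> ! i a < \<pi> ! i b \<longleftrightarrow> \<rho> ! a < \<rho> ! b) \<and> (\<pi> ! i a > \<pi> ! i b \<longleftrightarrow> \<rho> ! a > \<rho> ! b)"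
    unfolding contains_def by blast
  define js where "js = map i [0..<length \<rho>]"
  have "sorted_wrt (<) js"
    using i(1) by (auto simp: js_def sorted_wrt_iff_nth_less strict_mono_on_def)
  moreover have "set js \<subseteq> {..<length \<pi>}" using i(2) by (auto simp: js_def image_subset_iff)
  ultimately have "subseq (map ((!) \<pi>) js) \<pi>" by (rule subseq_map_nth)
  moreover have "order_iso (map ((!) \<pi>) js) \<rho>"
    using i(3) by (auto simp: order_iso_def js_def)
  ultimately show "\<exists>\<sigma>. subseq \<sigma> \<pi> \<and> order_iso \<sigma> \<rho>" by blast
next
  assume "\<exists>\<sigma>. subseq \<sigma> \<pi> \<and> order_iso \<sigma> \<rho>"
  then obtain \<sigma> where \<sigma>: "subseq \<sigma> \<pi>" "order_iso \<sigma> \<rho>" by blast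
  from subseq_imp_strict_mono_nth[OF \<sigma>(1)] \<sigma>(2) show "contains \<pi> \<rho>"
    unfolding contains_def order_iso_def by (metis (no_types, lifting))
qed

text \<open>Evaluating the finitely many comparisons turns order isomorphism into the explicit shape
  \<open>[x,y,x]\<close>. The four lemmas below follow the same scheme.\<close>

lemma avoids_121: "avoids w [1,2,1] \<longleftrightarrow> (\<forall>x y. x < y \<longrightarrow> \<not> subseq [x,y,x] w)"
proof -
  have "order_iso \<sigma> [1,2,1] \<longleftrightarrow> (\<exists>x y. x < y \<and> \<sigma> = [x,y,x])" for \<sigma>
    by (auto simp: order_iso_def All_less_Suc numeral_3_eq_3 length_Suc_conv)
  then show ?thesis by (simp only: avoids_def contains_iff_subseq) blast
qed

lemma avoids_112: "avoids w [1,1,2] \<longleftrightarrow> (\<forall>x y. x < y \<longrightarrow> \<not> subseq [x,x,y] w)"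
proof -
  have "order_iso \<sigma> [1,1,2] \<longleftrightarrow> (\<exists>x y. x < y \<and> \<sigma> = [x,x,y])" for \<sigma>
    by (auto simp: order_iso_def All_less_Suc numeral_3_eq_3 length_Suc_conv)
  then show ?thesis by (simp only: avoids_def contains_iff_subseq) blast
qed

lemma avoids_1322: "avoids w [1,3,2,2] \<longleftrightarrow> (\<forall>x y z. x < y \<longrightarrow> y < z \<longrightarrow> \<not> subseq [x,z,y,y] w)"
proof -
  have "order_iso \<sigma> [1,3,2,2] \<longleftrightarrow> (\<exists>x y z. x < y \<and> y < z \<and> \<sigma> = [x,z,y,y])" for \<sigma>
    by (auto simp: order_iso_def All_less_Suc numeral_3_eq_3 length_Suc_conv)
  then show ?thesis by (simp only: avoids_def contains_iff_subseq) blast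
qed

lemma avoids_1232: "avoids w [1,2,3,2] \<longleftrightarrow> (\<forall>x y z. x < y \<longrightarrow> y < z \<longrightarrow> \<not> subseq [x,y,z,y] w)"
proof -
  have "order_iso \<sigma> [1,2,3,2] \<longleftrightarrow> (\<exists>x y z. x < y \<and> y < z \<and> \<sigma> = [x,y,z,y])" for \<sigma>
    by (auto simp: order_iso_def All_less_Suc numeral_3_eq_3 length_Suc_conv)
  then show ?thesis by (simp only: avoids_def contains_iff_subseq) blast
qed

lemma avoids_2132: "avoids w [2,1,3,2] \<longleftrightarrow> (\<forall>x y z. x < y \<longrightarrow> y < z \<longrightarrow> \<not> subseq [y,x,z,y] w)"
proof -
  have "order_iso \<sigma> [2,1,3,2] \<longleftrightarrow> (\<exists>x y z. x < y \<and> y < z \<and> \<sigma> = [y,x,z,y])" for \<sigma>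
    by (auto simp: order_iso_def All_less_Suc numeral_3_eq_3 length_Suc_conv)
  then show ?thesis by (simp only: avoids_def contains_iff_subseq) blast
qed

section \<open>Inserting the smallest letter\<close>

text \<open>
  The sum of \<open>g d\<close> over the words with \<open>d\<close> admissible gaps at the leaves of the generating tree; the
  list holds the multiplicities from the smallest letter on, so its head is the last letter inserted.
\<close>

fun tree_sum :: "nat list \<Rightarrow> (nat \<Rightarrow> nat) \<Rightarrow> nat" where
  "tree_sum [] g = g 1"
| "tree_sum (a # as) g = tree_sum as (\<lambda>d. if a = 1 then d * g (d + 1) else (\<Sum>j\<in>{a<..a + d}. g j))"

text \<open>A gap is encoded by the length of the prefix before it, so 0 and \<open>length w\<close>
  stand for the two ends of the word.\<close>

definition gaps :: "(nat list \<Rightarrow> nat list \<Rightarrow> bool) \<Rightarrow> nat list \<Rightarrow> nat set" where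
  "gaps adm w = {p. p \<le> length w \<and> adm (take p w) (drop p w)}"

lemma finite_gaps: "finite (gaps adm w)"
  by (simp add: gaps_def)

text \<open>\<open>takeWhile_ins\<close> and \<open>filter_ins\<close> make insertion injective,
  \<open>good_ins\<close> and \<open>ins_exhaust\<close> make it reach exactly the good words with
  smallest letter \<open>i\<close>, and the last two assumptions are the succession rule for the
  number of gaps.\<close>

locale insertion_scheme =
  fixes good :: "nat list \<Rightarrow> bool"
    and adm :: "nat list \<Rightarrow> nat list \<Rightarrow> bool"
    and ins :: "nat \<Rightarrow> nat \<Rightarrow> nat list \<Rightarrow> nat list \<Rightarrow> nat list"
  assumes good_Nil: "good []"
    and adm_Nil: "adm [] []"
    and mset_ins: "a \<ge> 1 \<Longrightarrow> mset (ins i a u v) = mset (u @ v) + replicate_mset a i"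
    and takeWhile_ins: "a \<ge> 1 \<Longrightarrow> i \<notin> set u \<Longrightarrow> takeWhile (\<lambda>x. x \<noteq> i) (ins i a u v) = u"
    and filter_ins: "a \<ge> 1 \<Longrightarrow> i \<notin> set (u @ v) \<Longrightarrow> filter (\<lambda>x. x \<noteq> i) (ins i a u v) = u @ v"
    and good_ins: "a \<ge> 1 \<Longrightarrow> \<forall>x\<in>set (u @ v). i < x \<Longrightarrow> good (ins i a u v) \<longleftrightarrow> good (u @ v) \<and> adm u v"
    and ins_exhaust: "good w \<Longrightarrow> i \<in> set w \<Longrightarrow> \<forall>x\<in>set w. i \<le> x \<Longrightarrow>
      \<exists>a u v. a \<ge> 1 \<and> i \<notin> set (u @ v) \<and> w = ins i a u v"
    and card_gaps_ins_1: "\<forall>x\<in>set (u @ v). i < x \<Longrightarrow> adm u v \<Longrightarrow>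
      card (gaps adm (ins i 1 u v)) = card (gaps adm (u @ v)) + 1"
    and card_gaps_ins_bij: "a \<ge> 2 \<Longrightarrow> good w \<Longrightarrow> \<forall>x\<in>set w. i < x \<Longrightarrow>
      bij_betw (\<lambda>p. card (gaps adm (ins i a (take p w) (drop p w)))) (gaps adm w) {a<..a + card (gaps adm w)}"
begin

definition words :: "nat multiset \<Rightarrow> nat list set" where
  "words S = {w \<in> permutations_of_multiset S. good w}"

lemma finite_words: "finite (words S)"
  by (simp add: words_def)

text \<open>Parent and gap can be read off from the child: deleting \<open>i\<close> returns the
  parent, and the prefix before the first \<open>i\<close> has the length that encodes the
  gap.\<close>

lemma bij_betw_ins:
  assumes "\<forall>x\<in>#S. i < x" "a \<ge> 1"
  shows "bij_betw (\<lambda>(w, p). ins i a (take p w) (drop p w)) (SIGMA w:words S. gaps adm w)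
    (words (S + replicate_mset a i))"
  unfolding bij_betw_def
proof (intro conjI inj_onI equalityI subsetI)
  have inv: "filter (\<lambda>x. x \<noteq> i) (ins i a (take p w) (drop p w)) = w \<and>
      length (takeWhile (\<lambda>x. x \<noteq> i) (ins i a (take p w) (drop p w))) = p"
    if "w \<in> words S" "p \<in> gaps adm w" for w p
  proof -
    have "i \<notin> set w" using that(1) assms(1) by (auto simp: words_def permutations_of_multiset_def)
    then show ?thesis using that(2) assms(2) filter_ins[of a i "take p w" "drop p w"]
      by (subst takeWhile_ins) (auto simp: gaps_def min_def simp flip: set_append dest: in_set_takeD)
  qed
  fix s t
  assume "s \<in> Sigma (words S) (gaps adm)" "t \<in> Sigma (words S) (gaps adm)"
    "(\<lambda>(w, p). ins i a (take p w) (drop p w)) s = (\<lambda>(w, p). ins i a (take p w) (drop p w)) t"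
  then show "s = t" using inv by (cases s, cases t) (clarsimp, metis)
next
  fix w' assume "w' \<in> (\<lambda>(w, p). ins i a (take p w) (drop p w)) ` (SIGMA w:words S. gaps adm w)"
  then obtain w p where w: "w \<in> words S" "p \<in> gaps adm w" "w' = ins i a (take p w) (drop p w)" by auto
  have "\<forall>x\<in>set (take p w @ drop p w). i < x"
    using w(1) assms(1) by (auto simp: words_def permutations_of_multiset_def)
  from good_ins[OF assms(2) this] mset_ins[OF assms(2), of i "take p w" "drop p w"]
  show "w' \<in> words (S + replicate_mset a i)"
    using w by (auto simp: words_def permutations_of_multiset_def gaps_def simp flip: mset_append)
next
  fix w' assume w': "w' \<in> words (S + replicate_mset a i)"
  then have m: "mset w' = S + replicate_mset a i" and g: "good w'"
    by (auto simp: words_def permutations_of_multiset_def)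
  have s: "set w' = set_mset S \<union> {i}" using arg_cong[OF m, of set_mset] assms(2) by auto
  have "i \<in> set w'" "\<forall>x\<in>set w'. i \<le> x" using s assms(1) by auto
  from ins_exhaust[OF g this] obtain b u v where b: "b \<ge> 1" "i \<notin> set (u @ v)" "w' = ins i b u v"
    by blast
  \<comment> \<open>\<open>ins_exhaust\<close> yields some multiplicity \<open>b\<close>; counting
    \<open>i\<close> on both sides forces \<open>b = a\<close>, and cancelling leaves
    \<open>mset (u @ v) = S\<close>.\<close>
  have eq: "mset (u @ v) + replicate_mset b i = S + replicate_mset a i"
    using b m mset_ins by metis
  have "i \<notin># mset (u @ v)" "i \<notin># S"
    using b(2) assms(1) by auto
  then have "count (mset (u @ v)) i = 0" "count S i = 0"
    by (metis count_eq_zero_iff)+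
  then have "b = a" using arg_cong[OF eq, of "\<lambda>M. count M i"] 
    by (metis add_0 count_replicate_mset count_union)
  then have uv: "mset (u @ v) = S" using eq by simp
  then have "\<forall>x\<in>set (u @ v). i < x" using assms(1) by (metis set_mset_mset)
  then have "good (u @ v) \<and> adm u v" using good_ins b g by blast
  then have "(u @ v, length u) \<in> (SIGMA w:words S. gaps adm w)"
    using uv by (auto simp: words_def gaps_def permutations_of_multiset_def)
  moreover have "w' = (\<lambda>(w, p). ins i a (take p w) (drop p w)) (u @ v, length u)"
    using b \<open>b = a\<close> by simp
  ultimately show "w' \<in> (\<lambda>(w, p). ins i a (take p w) (drop p w)) ` (SIGMA w:words S. gaps adm w)"
    by blast
qed

text \<open>The children are grouped by parent. If a parent has \<open>d\<close> gaps, its children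
  all have the same gap count for \<open>a = 1\<close>, and their gap counts run once through
  \<open>{a<..a + d}\<close> for \<open>a \<ge> 2\<close>.\<close>

lemma sum_words_step:
  assumes "\<forall>x\<in>#S. i < x" "a \<ge> 1"
  shows "(\<Sum>w\<in>words (S + replicate_mset a i). g (card (gaps adm w))) =
    (\<Sum>w\<in>words S. (\<lambda>d. if a = 1 then d * g (d + 1) else (\<Sum>j\<in>{a<..a + d}. g j)) (card (gaps adm w)))"
proof -
  have "(\<Sum>w\<in>words (S + replicate_mset a i). g (card (gaps adm w))) =
      (\<Sum>(w, p)\<in>(SIGMA w:words S. gaps adm w). g (card (gaps adm (ins i a (take p w) (drop p w)))))"
    by (subst sum.reindex_bij_betw[OF bij_betw_ins[OF assms], symmetric]) (simp add: case_prod_beta)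
  also have "\<dots> = (\<Sum>w\<in>words S. \<Sum>p\<in>gaps adm w. g (card (gaps adm (ins i a (take p w) (drop p w)))))"
    by (subst sum.Sigma) (auto simp: finite_words finite_gaps)
  also have "\<dots> = (\<Sum>w\<in>words S. (\<lambda>d. if a = 1 then d * g (d + 1) else (\<Sum>j\<in>{a<..a + d}. g j)) (card (gaps adm w)))"
  proof (rule sum.cong[OF refl])
    fix w assume "w \<in> words S"
    then have w: "good w" "\<forall>x\<in>set w. i < x"
      using assms(1) by (auto simp: words_def permutations_of_multiset_def)
    show "(\<Sum>p\<in>gaps adm w. g (card (gaps adm (ins i a (take p w) (drop p w))))) =
      (if a = 1 then card (gaps adm w) * g (card (gaps adm w) + 1) else (\<Sum>j\<in>{a<..a + card (gaps adm w)}. g j))"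
    proof (cases "a = 1")
      case True
      have "card (gaps adm (ins i 1 (take p w) (drop p w))) = card (gaps adm w) + 1" if "p \<in> gaps adm w" for p
        using card_gaps_ins_1[of "take p w" "drop p w" i] w(2) that by (simp add: gaps_def)
      then show ?thesis using True by simp
    next
      case False
      then have "a \<ge> 2" using assms(2) by simp
      from sum.reindex_bij_betw[OF card_gaps_ins_bij[OF this w], of g] show ?thesis
        using False by simp
    qed
  qed
  finally show ?thesis .
qed

text \<open>The weight \<open>g\<close> stays arbitrary because each induction step replaces it by
  the weight that sums over children. Sorting puts the smallest letter, inserted last, at the
  head.\<close>

lemma sum_words:
  assumes "sorted_wrt (<) is" "set is = set_mset S"
  shows "(\<Sum>w\<in>words S. g (card (gaps adm w))) = tree_sum (map (count S) is) g"
  using assms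
proof (induction "is" arbitrary: S g)
  case Nil
  then have "S = {#}" by (metis empty_set set_mset_eq_empty_iff)
  \<comment> \<open>The empty word has the single gap 0, which matches \<open>g 1\<close> in the
    base case of \<open>tree_sum\<close>.\<close>
  then have "words S = {[]}" "gaps adm [] = {0}"
    using good_Nil adm_Nil by (auto simp: words_def gaps_def permutations_of_multiset_def)
  then show ?case by simp
next
  case (Cons i "is")
  define T where "T = filter_mset (\<lambda>x. x \<noteq> i) S"
  have S: "S = T + replicate_mset (count S i) i"
    unfolding T_def by (auto intro: multiset_eqI)
  have a: "count S i \<ge> 1" using Cons.prems(2) by (metis One_nat_def Suc_leI count_greater_zero_iff list.set_intros(1))
  have "set is = set_mset T" using Cons.prems by (auto simp: T_def)
  moreover have eq: "map (count T) is = map (count S) is" and "sorted_wrt (<) is"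
    using Cons.prems(1) by (auto simp: T_def)
  ultimately have IH: "(\<Sum>w\<in>words T. h (card (gaps adm w))) = tree_sum (map (count S) is) h" for h
    using Cons.IH[of T h] unfolding eq by blast
  have "\<forall>x\<in>#T. i < x" using Cons.prems \<open>set is = set_mset T\<close> by auto
  from sum_words_step[OF this a, of g] show ?case
    by (simp add: IH[symmetric] flip: S)
qed

text \<open>Constant weight 1 counts the words. The right-hand side mentions neither
  \<open>good\<close>, \<open>adm\<close> nor \<open>ins\<close>, so all schemes give the same
  number.\<close>

lemma card_words:
  "card (words S) = tree_sum (map (count S) (sorted_list_of_set (set_mset S))) (\<lambda>_. 1)"
  using sum_words[of "sorted_list_of_set (set_mset S)" S "\<lambda>_. 1"] by simp

end


section \<open>Subsequences and gaps of concatenated words\<close>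

lemma subseq_imp_set_subset: "subseq \<sigma> w \<Longrightarrow> set \<sigma> \<subseteq> set w"
  by (metis notin_set_nthsI subseq_conv_nths subsetI)

lemma subseq_filter_iff: "\<forall>x\<in>set \<sigma>. P x \<Longrightarrow> subseq \<sigma> (filter P w) \<longleftrightarrow> subseq \<sigma> w"
  by (metis filter_True subseq_filter subseq_filter_left subseq_order.trans)

text \<open>The head of an embedded \<open>i # \<sigma>\<close> can be moved to the first
  \<open>i\<close>, which leaves the most room for \<open>\<sigma>\<close>.\<close>

lemma subseq_first_occurrence: "i \<notin> set u \<Longrightarrow> subseq (i # \<sigma>) (u @ i # v) \<longleftrightarrow> subseq \<sigma> v"
  by (induction u) auto

lemma subseq_replicate_append:
  "y \<noteq> i \<Longrightarrow> subseq (y # \<sigma>) (replicate n i @ v) \<longleftrightarrow> subseq (y # \<sigma>) v"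
  by (induction n) auto

text \<open>Only further copies of \<open>i\<close> stand behind the first \<open>i\<close> of this
  word.\<close>

lemma not_subseq_append_replicate:
  assumes "i \<notin> set v" "y \<noteq> i"
  shows "\<not> subseq [i, y] (v @ replicate b i)"
proof (cases b)
  case 0
  then show ?thesis using assms subseq_imp_set_subset[of "[i, y]" v] by auto
next
  case (Suc c)
  have "\<not> subseq [y] (replicate c i)" using assms(2) by (auto simp: subseq_singleton_left)
  then show ?thesis using subseq_first_occurrence[OF assms(1)] Suc by simp
qed

text \<open>Filtering both words to the letter \<open>i\<close> would embed at least two letters
  into one.\<close>

lemma not_subseq_single:
  assumes "i \<notin> set (u @ v)" "length (filter (\<lambda>x. x = i) \<sigma>) \<ge> 2"
  shows "\<not> subseq \<sigma> (u @ i # v)"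
proof
  assume "subseq \<sigma> (u @ i # v)"
  then have "subseq (filter (\<lambda>x. x = i) \<sigma>) (filter (\<lambda>x. x = i) (u @ i # v))"
    by (rule subseq_filter)
  moreover have "filter (\<lambda>x. x = i) (u @ i # v) = [i]" proof -
    have "filter (\<lambda>x. x = i) u = []" "filter (\<lambda>x. x = i) v = []"
      using assms(1) by (auto simp: filter_empty_conv)
    then show ?thesis by simp
  qed
  ultimately show False using assms(2) list_emb_length by fastforce
qed

text \<open>The gap at the seam belongs to the second summand, hence the strict bound
  \<open>p < length x\<close>; positions in that summand are shifted by
  \<open>length x\<close>.\<close>

lemma card_gaps_append:
  "card (gaps adm (x @ y)) =
    card {p. p < length x \<and> adm (take p x) (drop p x @ y)} + card (gaps (\<lambda>u. adm (x @ u)) y)"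
proof -
  have "gaps adm (x @ y) = {p. p < length x \<and> adm (take p x) (drop p x @ y)} \<union>
      (+) (length x) ` gaps (\<lambda>u. adm (x @ u)) y" (is "_ = ?A \<union> ?B")
  proof (intro set_eqI iffI)
    fix p assume p: "p \<in> gaps adm (x @ y)"
    show "p \<in> ?A \<union> ?B"
    proof (cases "p < length x")
      case False
      then have "p = length x + (p - length x)" "p - length x \<in> gaps (\<lambda>u. adm (x @ u)) y"
        using p by (auto simp: gaps_def)
      then show ?thesis by blast
    qed (use p in \<open>auto simp: gaps_def\<close>)
  qed (auto simp: gaps_def)
  moreover have "card (?A \<union> ?B) = card ?A + card ?B"
    by (intro card_Un_disjoint) (auto simp: gaps_def)
  ultimately show ?thesis by (simp add: card_image)
qed

text \<open>The new letter cuts the gap between \<open>u\<close> and \<open>v\<close> into two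
  admissible gaps, before and behind \<open>i\<close>, while every other gap keeps its
  status.\<close>

lemma card_gaps_insert_single:
  assumes "\<And>s t. u = s @ t \<Longrightarrow> adm s (t @ i # v) \<longleftrightarrow> adm s (t @ v)"
    and "\<And>s t. v = s @ t \<Longrightarrow> adm (u @ i # s) t \<longleftrightarrow> adm (u @ s) t"
    and "adm u v"
  shows "card (gaps adm (u @ i # v)) = card (gaps adm (u @ v)) + 1"
proof -
  have "{p. p < length u \<and> adm (take p u) (drop p u @ i # v)} =
      {p. p < length u \<and> adm (take p u) (drop p u @ v)}"
    using assms(1) by (metis append_take_drop_id)
  moreover have "card (gaps (\<lambda>s. adm (u @ s)) ([i] @ v)) = 1 + card (gaps (\<lambda>s. adm (u @ i # s)) v)"
  proof -
    \<comment> \<open>This is the gap directly before \<open>i\<close>, the case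
      \<open>t = []\<close> of the first assumption.\<close>
    have "{p. p < length [i] \<and> adm (u @ take p [i]) (drop p [i] @ v)} = {0}"
      using assms(1)[of u "[]"] assms(3) by auto
    then show ?thesis by (subst card_gaps_append) simp
  qed
  moreover have "gaps (\<lambda>s. adm (u @ i # s)) v = gaps (\<lambda>s. adm (u @ s)) v"
    using assms(2) unfolding gaps_def by (metis append_take_drop_id)
  ultimately show ?thesis by (simp add: card_gaps_append)
qed

text \<open>Injectivity and bounds suffice, since both sets have the same finite size.\<close>

lemma bij_betw_card_interval:
  fixes f :: "nat \<Rightarrow> nat"
  assumes "finite A" "inj_on f A" "\<And>p. p \<in> A \<Longrightarrow> a < f p \<and> f p \<le> a + card A"
  shows "bij_betw f A {a<..a + card A}"
proof -
  have "f ` A \<subseteq> {a<..a + card A}" using assms(3) by auto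
  moreover have "card (f ` A) = card {a<..a + card A}" using assms(2) by (simp add: card_image)
  ultimately show ?thesis using assms(2) by (simp add: bij_betw_def card_subset_eq)
qed

section \<open>The three insertion schemes\<close>

definition ins_block :: "nat \<Rightarrow> nat \<Rightarrow> nat list \<Rightarrow> nat list \<Rightarrow> nat list" where
  "ins_block i a u v = u @ replicate a i @ v"

definition ins_split :: "nat \<Rightarrow> nat \<Rightarrow> nat list \<Rightarrow> nat list \<Rightarrow> nat list" where
  "ins_split i a u v = u @ i # v @ replicate (a - 1) i"

definition good_121_1322 :: "nat list \<Rightarrow> bool" where
  "good_121_1322 w \<longleftrightarrow> (\<forall>x y. x < y \<longrightarrow> \<not> subseq [x,y,x] w) \<and>
    (\<forall>x y z. x < y \<longrightarrow> y < z \<longrightarrow> \<not> subseq [x,z,y,y] w)"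

definition good_112_1232 :: "nat list \<Rightarrow> bool" where
  "good_112_1232 w \<longleftrightarrow> (\<forall>x y. x < y \<longrightarrow> \<not> subseq [x,x,y] w) \<and>
    (\<forall>x y z. x < y \<longrightarrow> y < z \<longrightarrow> \<not> subseq [x,y,z,y] w)"

definition good_112_2132 :: "nat list \<Rightarrow> bool" where
  "good_112_2132 w \<longleftrightarrow> (\<forall>x y. x < y \<longrightarrow> \<not> subseq [x,x,y] w) \<and>
    (\<forall>x y z. x < y \<longrightarrow> y < z \<longrightarrow> \<not> subseq [y,x,z,y] w)"

definition adm_211 :: "nat list \<Rightarrow> nat list \<Rightarrow> bool" where
  "adm_211 u v \<longleftrightarrow> (\<forall>y z. y < z \<longrightarrow> \<not> subseq [z,y,y] v)"

definition adm_121 :: "nat list \<Rightarrow> nat list \<Rightarrow> bool" where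
  "adm_121 u v \<longleftrightarrow> (\<forall>y z. y < z \<longrightarrow> \<not> subseq [y,z,y] v)"

text \<open>Both sides of the gap matter here, so the admissible gaps need not form a final segment:
  in 232 the gaps 0, 2 and 3 are admissible, but 1 is not.\<close>

definition adm_1_21 :: "nat list \<Rightarrow> nat list \<Rightarrow> bool" where
  "adm_1_21 u v \<longleftrightarrow> (\<forall>y z. y < z \<longrightarrow> y \<in> set u \<longrightarrow> \<not> subseq [z,y] v)"

section \<open>Recovering the pieces of an inserted word\<close>

lemma filter_eq_same: "i \<notin> set w \<Longrightarrow> filter (\<lambda>x. x \<noteq> i) w = w"
  by (auto simp: filter_id_conv)

lemma filter_ins_block: "a \<ge> 1 \<Longrightarrow> i \<notin> set (u @ v) \<Longrightarrow> filter (\<lambda>x. x \<noteq> i) (ins_block i a u v) = u @ v"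
  by (simp add: ins_block_def filter_eq_same)

lemma filter_ins_split: "i \<notin> set (u @ v) \<Longrightarrow> filter (\<lambda>x. x \<noteq> i) (ins_split i a u v) = u @ v"
  by (simp add: ins_split_def filter_eq_same)

lemma set_ins_block: "a \<ge> 1 \<Longrightarrow> set (ins_block i a u v) = insert i (set (u @ v))"
  by (auto simp: ins_block_def)

lemma set_ins_split: "set (ins_split i a u v) = insert i (set (u @ v))"
  by (auto simp: ins_split_def)

lemma takeWhile_ins_block: "a \<ge> 1 \<Longrightarrow> i \<notin> set u \<Longrightarrow> takeWhile (\<lambda>x. x \<noteq> i) (ins_block i a u v) = u"
  by (cases a) (auto simp: ins_block_def takeWhile_append)

lemma takeWhile_ins_split: "i \<notin> set u \<Longrightarrow> takeWhile (\<lambda>x. x \<noteq> i) (ins_split i a u v) = u"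
  by (auto simp: ins_split_def takeWhile_append)

lemma mset_ins_split: "a \<ge> 1 \<Longrightarrow> mset (ins_split i a u v) = mset (u @ v) + replicate_mset a i"
  by (cases a) (auto simp: ins_split_def)

section \<open>Patterns created by the inserted letters\<close>

lemma subseq_other_iff:
  assumes "filter (\<lambda>x. x \<noteq> i) w' = w" "i \<notin> set \<sigma>"
  shows "subseq \<sigma> w' \<longleftrightarrow> subseq \<sigma> w"
  using subseq_filter_iff[of \<sigma> "\<lambda>x. x \<noteq> i" w'] assms by metis

lemma subseq_append_replicate_iff:
  assumes "i \<notin> set v" "i \<notin> set \<sigma>"
  shows "subseq \<sigma> (v @ replicate n i) \<longleftrightarrow> subseq \<sigma> v"
proof -
  have "filter (\<lambda>x. x \<noteq> i) (v @ replicate n i) = v" using assms(1) by (simp add: filter_eq_same)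
  then show ?thesis using assms(2) by (rule subseq_other_iff)
qed

text \<open>A new occurrence must use \<open>i\<close>, and only as its smallest letter. In 121 this
  would need a larger letter between two copies of \<open>i\<close>, which a block excludes; in 1322
  the remaining \<open>z y y\<close> must lie in \<open>v\<close>.\<close>

lemma good_ins_block:
  assumes a: "a \<ge> 1" and gt: "\<forall>x\<in>set (u @ v). i < x"
  shows "good_121_1322 (ins_block i a u v) \<longleftrightarrow> good_121_1322 (u @ v) \<and> adm_211 u v"
proof -
  let ?w = "ins_block i a u v"
  have ni: "i \<notin> set u" "i \<notin> set v" "i \<notin> set (u @ v)" using gt by auto
  note other = subseq_other_iff[OF filter_ins_block[OF a ni(3)]]
  have mono: "subseq \<sigma> ?w" if "subseq \<sigma> (u @ v)" for \<sigma>
    using that subseq_filter_left[of "\<lambda>x. x \<noteq> i" ?w]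
    unfolding filter_ins_block[OF a ni(3)] by (rule subseq_order.trans)
  have low: "i \<le> x" if "subseq \<sigma> ?w" "x \<in> set \<sigma>" for \<sigma> x
  proof -
    have "x \<in> insert i (set (u @ v))"
      using subseq_imp_set_subset[OF that(1)] that(2) set_ins_block[OF a, of i u v] by blast
    then show ?thesis using gt by (auto intro: less_imp_le)
  qed
  obtain b where b: "a = Suc b" using a by (cases a) auto
  \<comment> \<open>Once the first \<open>i\<close> is used, the next letter differs from
    \<open>i\<close> and skips the rest of the block.\<close>
  have lead: "subseq (i # y # \<sigma>) ?w \<longleftrightarrow> subseq (y # \<sigma>) v" if "y \<noteq> i" for y \<sigma>
    using that subseq_first_occurrence[OF ni(1)] subseq_replicate_append[OF that]
    by (simp add: ins_block_def b)
  have p121: "subseq [x,y,x] ?w \<longleftrightarrow> subseq [x,y,x] (u @ v)" if "x < y" for x y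
  proof (cases "x = i")
    case True
    then show ?thesis
      using that lead[of y "[i]"] subseq_imp_set_subset[of "[y,i]" v] subseq_imp_set_subset[of "[i,y,i]" "u @ v"] ni
      by auto
  next
    case False
    then show ?thesis
    proof (cases "subseq [x,y,x] ?w")
      case True
      then have "i \<le> x" using low[OF True, of x] by simp
      then show ?thesis using False that other[of "[x,y,x]"] by simp
    qed (use mono in blast)
  qed
  have p1322: "(\<forall>x y z. x < y \<longrightarrow> y < z \<longrightarrow> \<not> subseq [x,z,y,y] ?w) \<longleftrightarrow>
    (\<forall>x y z. x < y \<longrightarrow> y < z \<longrightarrow> \<not> subseq [x,z,y,y] (u @ v)) \<and> adm_211 u v"
    (is "?L \<longleftrightarrow> ?R1 \<and> _")
  proof (intro iffI conjI)
    assume L: ?L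
    show ?R1
      using L mono by blast
    show "adm_211 u v"
      unfolding adm_211_def
    proof (intro allI impI notI)
      fix y z assume "y < z" "subseq [z,y,y] v"
      moreover from this have "i < y" using subseq_imp_set_subset[of "[z,y,y]" v] gt by auto
      ultimately show False using L lead[of z "[y,y]"] by auto
    qed
  next
    assume R: "?R1 \<and> adm_211 u v"
    show ?L
    proof (intro allI impI notI)
      fix x y z assume *: "x < y" "y < z" "subseq [x,z,y,y] ?w"
      show False
      proof (cases "x = i")
        case True
        then show False using * R lead[of z "[y,y]"] by (auto simp: adm_211_def)
      next
        case False
        then have "i < x" using low[OF *(3), of x] by auto
        then show False using * R other[of "[x,z,y,y]"] by auto
      qed
    qed
  qed
  show ?thesis unfolding good_121_1322_def p1322 using p121 by blast
qed

text \<open>Behind the first \<open>i\<close> come \<open>v\<close> and then only copies of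
  \<open>i\<close>, so no larger letter follows a second \<open>i\<close>. Occurrences with
  \<open>x > i\<close> see only \<open>u @ v\<close>.\<close>

lemma subseq_112_ins_split:
  assumes gt: "\<forall>x\<in>set (u @ v). i < x" and xy: "x < y"
  shows "subseq [x,x,y] (ins_split i a u v) \<longleftrightarrow> subseq [x,x,y] (u @ v)" (is "?L \<longleftrightarrow> ?R")
proof -
  have ni: "i \<notin> set u" "i \<notin> set v" "i \<notin> set (u @ v)" using gt by auto
  have "\<not> subseq [i,i,y] (ins_split i a u v)" if "i < y"
    using that not_subseq_append_replicate[OF ni(2), of y "a - 1"] subseq_first_occurrence[OF ni(1)]
    by (simp add: ins_split_def)
  moreover have "i \<le> x" if ?L
  proof -
    have "x \<in> insert i (set (u @ v))"
      using subseq_imp_set_subset[OF that] set_ins_split[of i a u v] by simp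
    then show ?thesis using gt by (auto intro: less_imp_le)
  qed
  moreover have "i < x" if ?R
    using subseq_imp_set_subset[OF that] gt by (metis insert_subset list.simps(15))
  moreover have "?L \<longleftrightarrow> ?R" if "i < x"
    using that xy subseq_other_iff[OF filter_ins_split[OF ni(3)], of "[x,x,y]" a] by simp
  ultimately show ?thesis using xy by (metis le_neq_implies_less)
qed

text \<open>If \<open>i\<close> plays the 1, it may be taken to be the first \<open>i\<close>; the
  remaining \<open>y z y\<close> consists of larger letters behind it and thus lies in
  \<open>v\<close>.\<close>

lemma good_ins_split_1232:
  assumes gt: "\<forall>x\<in>set (u @ v). i < x"
  shows "good_112_1232 (ins_split i a u v) \<longleftrightarrow> good_112_1232 (u @ v) \<and> adm_121 u v"
proof -
  let ?w = "ins_split i a u v"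
  have ni: "i \<notin> set u" "i \<notin> set v" "i \<notin> set (u @ v)" using gt by auto
  note other = subseq_other_iff[OF filter_ins_split[OF ni(3), of a]]
  have mono: "subseq \<sigma> ?w" if "subseq \<sigma> (u @ v)" for \<sigma>
    using that subseq_filter_left[of "\<lambda>x. x \<noteq> i" ?w]
    unfolding filter_ins_split[OF ni(3), of a] by (rule subseq_order.trans)
  have low: "i \<le> x" if "subseq \<sigma> ?w" "x \<in> set \<sigma>" for \<sigma> x
  proof -
    have "x \<in> insert i (set (u @ v))"
      using subseq_imp_set_subset[OF that(1)] that(2) set_ins_split[of i a u v] by blast
    then show ?thesis using gt by (auto intro: less_imp_le)
  qed
  have lead: "subseq (i # \<sigma>) ?w \<longleftrightarrow> subseq \<sigma> v" if "i \<notin> set \<sigma>" for \<sigma>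
    using subseq_append_replicate_iff[OF ni(2) that] subseq_first_occurrence[OF ni(1)]
    unfolding ins_split_def by metis
  have "(\<forall>x y z. x < y \<longrightarrow> y < z \<longrightarrow> \<not> subseq [x,y,z,y] ?w) \<longleftrightarrow>
    (\<forall>x y z. x < y \<longrightarrow> y < z \<longrightarrow> \<not> subseq [x,y,z,y] (u @ v)) \<and> adm_121 u v"
    (is "?L \<longleftrightarrow> ?R1 \<and> _")
  proof (intro iffI conjI)
    assume L: ?L
    show ?R1
      using L mono by blast
    show "adm_121 u v"
      unfolding adm_121_def
    proof (intro allI impI notI)
      fix y z assume "y < z" "subseq [y,z,y] v"
      moreover from this have "i < y" using subseq_imp_set_subset[of "[y,z,y]" v] gt by auto
      ultimately show False using L lead[of "[y,z,y]"] by auto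
    qed
  next
    assume R: "?R1 \<and> adm_121 u v"
    show ?L
    proof (intro allI impI notI)
      fix x y z assume *: "x < y" "y < z" "subseq [x,y,z,y] ?w"
      show False
      proof (cases "x = i")
        case True
        then show False using * R lead[of "[y,z,y]"] by (auto simp: adm_121_def)
      next
        case False
        then have "i < x" using low[OF *(3), of x] by auto
        then show False using * R other[of "[x,y,z,y]"] by auto
      qed
    qed
  qed
  moreover have "(\<forall>x y. x < y \<longrightarrow> \<not> subseq [x,x,y] ?w) \<longleftrightarrow>
    (\<forall>x y. x < y \<longrightarrow> \<not> subseq [x,x,y] (u @ v))"
    by (simp add: subseq_112_ins_split[OF gt])
  ultimately show ?thesis unfolding good_112_1232_def by simp
qed

text \<open>The smallest letter of 2132 stands second, so \<open>i\<close> needs a \<open>y\<close>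
  before it and \<open>z y\<close> behind it; this is why \<open>adm_1_21\<close> looks at both
  sides of the gap.\<close>

lemma good_ins_split_2132:
  assumes gt: "\<forall>x\<in>set (u @ v). i < x"
  shows "good_112_2132 (ins_split i a u v) \<longleftrightarrow> good_112_2132 (u @ v) \<and> adm_1_21 u v"
proof -
  let ?w = "ins_split i a u v"
  have ni: "i \<notin> set u" "i \<notin> set v" "i \<notin> set (u @ v)" using gt by auto
  note other = subseq_other_iff[OF filter_ins_split[OF ni(3), of a]]
  have mono: "subseq \<sigma> ?w" if "subseq \<sigma> (u @ v)" for \<sigma>
    using that subseq_filter_left[of "\<lambda>x. x \<noteq> i" ?w]
    unfolding filter_ins_split[OF ni(3), of a] by (rule subseq_order.trans)
  have low: "i \<le> x" if "subseq \<sigma> ?w" "x \<in> set \<sigma>" for \<sigma> x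
  proof -
    have "x \<in> insert i (set (u @ v))"
      using subseq_imp_set_subset[OF that(1)] that(2) set_ins_split[of i a u v] by blast
    then show ?thesis using gt by (auto intro: less_imp_le)
  qed
  have rest: "subseq \<sigma> (v @ replicate (a - 1) i) \<longleftrightarrow> subseq \<sigma> v" if "i \<notin> set \<sigma>" for \<sigma>
    by (rule subseq_append_replicate_iff[OF ni(2) that])
  \<comment> \<open>Only the first \<open>i\<close> can play the 1: a copy in the final run has no
    larger letter behind it.\<close>
  have mid: "subseq [y,i,z,y] ?w \<longleftrightarrow> y \<in> set u \<and> subseq [z,y] v" if "i < y" "y < z" for y z
  proof
    assume "subseq [y,i,z,y] ?w"
    then obtain \<sigma> \<tau> where st: "[y,i,z,y] = \<sigma> @ \<tau>" "subseq \<sigma> u" "subseq \<tau> (i # v @ replicate (a - 1) i)"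
      unfolding ins_split_def by (auto simp: subseq_append_iff)
    have "i \<notin> set \<sigma>" using st(2) ni(1) subseq_imp_set_subset by blast
    \<comment> \<open>The part matched in \<open>u\<close> is free of \<open>i\<close>, hence empty
      or just \<open>y\<close>.\<close>
    then consider "\<sigma> = []" "\<tau> = [y,i,z,y]" | "\<sigma> = [y]" "\<tau> = [i,z,y]"
      using st(1) by (auto simp: Cons_eq_append_conv)
    then show "y \<in> set u \<and> subseq [z,y] v"
    proof cases
      case 1
      \<comment> \<open>With \<open>y\<close> matched behind the first \<open>i\<close>, the next
        \<open>i\<close> is in the final run, and \<open>z\<close> would have to follow it.\<close>
      then have "subseq [y,i,z,y] (v @ replicate (a - 1) i)" using st(3) that by auto
      then have "subseq [i,z,y] (v @ replicate (a - 1) i)" by (rule subseq_Cons')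
      moreover have "subseq [i,z] [i,z,y]" by auto
      ultimately have "subseq [i,z] (v @ replicate (a - 1) i)" using subseq_order.trans by blast
      then show ?thesis using not_subseq_append_replicate[OF ni(2), of z] that by auto
    next
      case 2
      then show ?thesis using st rest[of "[z,y]"] that by (auto simp: subseq_singleton_left)
    qed
  next
    assume "y \<in> set u \<and> subseq [z,y] v"
    then have "subseq ([y] @ [i] @ [z,y]) (u @ [i] @ v @ replicate (a - 1) i)"
      by (intro list_emb_append_mono) (auto simp: subseq_singleton_left intro: subseq_rev_drop_many)
    then show "subseq [y,i,z,y] ?w" by (simp add: ins_split_def)
  qed
  have "(\<forall>x y z. x < y \<longrightarrow> y < z \<longrightarrow> \<not> subseq [y,x,z,y] ?w) \<longleftrightarrow>
    (\<forall>x y z. x < y \<longrightarrow> y < z \<longrightarrow> \<not> subseq [y,x,z,y] (u @ v)) \<and> adm_1_21 u v"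
    (is "?L \<longleftrightarrow> ?R1 \<and> _")
  proof (intro iffI conjI)
    assume L: ?L
    show ?R1
      using L mono by blast
    show "adm_1_21 u v"
      unfolding adm_1_21_def
    proof (intro allI impI notI)
      fix y z assume "y < z" "y \<in> set u" "subseq [z,y] v"
      then show False using L mid[of y z] gt by auto
    qed
  next
    assume R: "?R1 \<and> adm_1_21 u v"
    show ?L
    proof (intro allI impI notI)
      fix x y z assume *: "x < y" "y < z" "subseq [y,x,z,y] ?w"
      show False
      proof (cases "x = i")
        case True
        then show False using * R mid[of y z] by (auto simp: adm_1_21_def)
      next
        case False
        then have "i < x" using low[OF *(3), of x] by auto
        then show False using * R other[of "[y,x,z,y]"] by auto
      qed
    qed
  qed
  moreover have "(\<forall>x y. x < y \<longrightarrow> \<not> subseq [x,x,y] ?w) \<longleftrightarrow>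
    (\<forall>x y. x < y \<longrightarrow> \<not> subseq [x,x,y] (u @ v))"
    by (simp add: subseq_112_ins_split[OF gt])
  ultimately show ?thesis unfolding good_112_2132_def by simp
qed

section \<open>Decomposing a good word at its smallest letter\<close>

lemma ins_block_exhaust:
  assumes "\<And>x y. x < y \<Longrightarrow> \<not> subseq [x,y,x] w" "i \<in> set w" "\<forall>x\<in>set w. i \<le> x"
  shows "\<exists>a u v. a \<ge> 1 \<and> i \<notin> set (u @ v) \<and> w = ins_block i a u v"
proof -
  obtain u r where ur: "w = u @ i # r" "i \<notin> set u" using split_list_first[OF assms(2)] by blast
  \<comment> \<open>\<open>v\<close> begins behind the maximal run of copies of \<open>i\<close>; an
    \<open>i\<close> in \<open>v\<close> would complete \<open>i y i\<close> with the first letter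
    \<open>y\<close> of \<open>v\<close>.\<close>
  define v where "v = dropWhile (\<lambda>x. x = i) r"
  define n where "n = length (takeWhile (\<lambda>x. x = i) r)"
  have "takeWhile (\<lambda>x. x = i) r = replicate n i"
    unfolding n_def by (metis (full_types) replicate_length_same set_takeWhileD)
  then have r: "r = replicate n i @ v" unfolding v_def by (metis takeWhile_dropWhile_id)
  have "i \<notin> set v"
  proof
    assume iv: "i \<in> set v"
    then obtain y t where yt: "v = y # t" by (cases v) auto
    have "y \<noteq> i" using yt unfolding v_def by (metis (full_types) dropWhile_eq_Cons_conv)
    moreover have "i \<le> y" using assms(3) ur r yt by auto
    ultimately have "i < y" "i \<in> set t" using yt iv by auto
    moreover from this have "subseq [i,y,i] w"
      using ur r yt by (auto simp: subseq_singleton_left intro!: subseq_drop_many)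
    ultimately show False using assms(1) by blast
  qed
  then show ?thesis
    using ur r by (intro exI[of _ "Suc n"] exI[of _ u] exI[of _ v]) (auto simp: ins_block_def)
qed

lemma ins_split_exhaust:
  assumes "\<And>x y. x < y \<Longrightarrow> \<not> subseq [x,x,y] w" "i \<in> set w" "\<forall>x\<in>set w. i \<le> x"
  shows "\<exists>a u v. a \<ge> 1 \<and> i \<notin> set (u @ v) \<and> w = ins_split i a u v"
proof -
  obtain u r where ur: "w = u @ i # r" "i \<notin> set u" using split_list_first[OF assms(2)] by blast
  show ?thesis
  proof (cases "i \<in> set r")
    case False
    then show ?thesis
      using ur by (intro exI[of _ 1] exI[of _ u] exI[of _ r]) (auto simp: ins_split_def)
  next
    case True
    then obtain v t where vt: "r = v @ i # t" "i \<notin> set v" using split_list_first[OF True] by blast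
    \<comment> \<open>A letter \<open>y > i\<close> behind the second \<open>i\<close> would
      complete \<open>i i y\<close>.\<close>
    have "y = i" if "y \<in> set t" for y
    proof (rule ccontr)
      assume "y \<noteq> i"
      moreover have "i \<le> y" using that assms(3) ur vt by auto
      ultimately have "i < y" by simp
      moreover have "subseq [i,i,y] w"
        using ur vt that by (auto simp: subseq_singleton_left intro!: subseq_drop_many)
      ultimately show False using assms(1) by blast
    qed
    then have "t = replicate (length t) i" by (metis replicate_length_same)
    \<comment> \<open>Two copies of \<open>i\<close> were split off explicitly, and \<open>t\<close>
      holds all others.\<close>
    then have "w = ins_split i (length t + 2) u v" using ur vt by (simp add: ins_split_def)
    then show ?thesis using ur vt by (metis Un_iff add_leD2 one_le_numeral order_trans set_append trans_le_add2)
  qed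
qed

section \<open>Counting admissible gaps after an insertion\<close>

lemma adm_insert_single:
  assumes gt: "\<forall>x\<in>set (u @ v). i < x"
  shows "u = s @ t \<Longrightarrow> adm_211 s (t @ i # v) \<longleftrightarrow> adm_211 s (t @ v)"
    and "u = s @ t \<Longrightarrow> adm_121 s (t @ i # v) \<longleftrightarrow> adm_121 s (t @ v)"
    and "u = s @ t \<Longrightarrow> adm_1_21 s (t @ i # v) \<longleftrightarrow> adm_1_21 s (t @ v)"
    and "v = s @ t \<Longrightarrow> adm_1_21 (u @ i # s) t \<longleftrightarrow> adm_1_21 (u @ s) t"
proof -
  show "adm_1_21 (u @ i # s) t \<longleftrightarrow> adm_1_21 (u @ s) t" if "v = s @ t"
  proof -
    \<comment> \<open>An \<open>i\<close> added on the left matters only through a subsequence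
      \<open>z i\<close> of \<open>t\<close>.\<close>
    have "i \<notin> set t" using that gt by auto
    then have "\<not> subseq [z, i] t" for z using subseq_imp_set_subset[of "[z,i]" t] by auto
    then show ?thesis by (auto simp: adm_1_21_def)
  qed
  assume u: "u = s @ t"
  have ni: "i \<notin> set (t @ v)" using u gt by auto
  have other: "subseq \<sigma> (t @ i # v) \<longleftrightarrow> subseq \<sigma> (t @ v)" if "i \<notin> set \<sigma>" for \<sigma>
    using that ni by (intro subseq_other_iff) (simp_all add: filter_eq_same)
  have low: "i \<le> x" if "subseq \<sigma> (t @ i # v)" "x \<in> set \<sigma>" for \<sigma> x
    using subseq_imp_set_subset[OF that(1)] that(2) gt u by (auto intro: less_imp_le)
  have mono: "subseq \<sigma> (t @ i # v)" if "subseq \<sigma> (t @ v)" for \<sigma>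
  proof -
    have "subseq (t @ v) (t @ i # v)" by (simp add: subseq_append' list_emb_Cons)
    then show ?thesis using that subseq_order.trans by blast
  qed
  \<comment> \<open>The repeated letter \<open>y\<close> is the smallest of the pattern, so a new
    occurrence would need two copies of \<open>i\<close>. The same holds for 121 below.\<close>
  have "subseq [z,y,y] (t @ i # v) \<longleftrightarrow> subseq [z,y,y] (t @ v)" if "y < z" for y z
    using that low[of "[z,y,y]" y] other[of "[z,y,y]"] mono not_subseq_single[OF ni, of "[z,y,y]"]
    by (cases "y = i") auto
  then show "adm_211 s (t @ i # v) \<longleftrightarrow> adm_211 s (t @ v)" by (auto simp: adm_211_def)
  have "subseq [y,z,y] (t @ i # v) \<longleftrightarrow> subseq [y,z,y] (t @ v)" if "y < z" for y z
    using that low[of "[y,z,y]" y] other[of "[y,z,y]"] mono not_subseq_single[OF ni, of "[y,z,y]"]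
    by (cases "y = i") auto
  then show "adm_121 s (t @ i # v) \<longleftrightarrow> adm_121 s (t @ v)" by (auto simp: adm_121_def)
  have "subseq [z,y] (t @ i # v) \<longleftrightarrow> subseq [z,y] (t @ v)" if "y < z" "y \<in> set s" for y z
  proof -
    have "i < y" using that(2) gt u by auto
    then show ?thesis using that(1) other[of "[z,y]"] by simp
  qed
  then show "adm_1_21 s (t @ i # v) \<longleftrightarrow> adm_1_21 s (t @ v)" by (auto simp: adm_1_21_def)
qed

lemma subseq_drop: "subseq \<sigma> (drop n w) \<Longrightarrow> subseq \<sigma> w"
  by (metis append_take_drop_id subseq_drop_many)

lemma adm_drop:
  assumes "n \<le> m"
  shows "adm_211 u (drop n w) \<Longrightarrow> adm_211 u' (drop m w)"
    and "adm_121 u (drop n w) \<Longrightarrow> adm_121 u' (drop m w)"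
  using assms subseq_drop[of _ "m - n" "drop n w"] by (auto simp: adm_211_def adm_121_def)

text \<open>Moving a gap to the right only shortens the suffix, so all of
  \<open>p, ..., length w\<close> are admissible. This yields the upper bounds in two of the
  succession rules.\<close>

lemma gaps_upward:
  assumes "p \<in> gaps adm w" "adm = adm_211 \<or> adm = adm_121"
  shows "length w - p < card (gaps adm w)"
proof -
  have "{p..length w} \<subseteq> gaps adm w" using assms adm_drop by (auto simp: gaps_def)
  then have "card {p..length w} \<le> card (gaps adm w)" by (intro card_mono finite_gaps)
  moreover have "p \<le> length w" using assms(1) by (simp add: gaps_def)
  ultimately show ?thesis by simp
qed

text \<open>Left of the block, a letter of \<open>u\<close> followed by \<open>i i\<close> is a 211;
  here \<open>a \<ge> 2\<close> enters. From the front of the block on, the first letter of a 211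
  would lie in \<open>v\<close>, behind all copies of \<open>i\<close>.\<close>

lemma card_gaps_ins_block:
  assumes gt: "\<forall>x\<in>set (u @ v). i < x" and "adm_211 u v" and a: "a \<ge> 2"
  shows "card (gaps adm_211 (ins_block i a u v)) = a + length v + 1"
proof -
  let ?w = "ins_block i a u v"
  have "adm_211 s (drop p ?w) \<longleftrightarrow> length u \<le> p" if "p \<le> length ?w" for s p
  proof
    assume L: "adm_211 s (drop p ?w)"
    show "length u \<le> p"
    proof (rule ccontr)
      assume "\<not> length u \<le> p"
      then obtain x t where x: "drop p u = x # t" "x \<in> set u"
        by (metis Cons_nth_drop_Suc not_le nth_mem)
      obtain b where b: "a = Suc (Suc b)" using a by (metis Suc_le_D numeral_2_eq_2 Suc_le_mono)
      have "subseq [x,i,i] (drop p ?w)"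
        using x(1) \<open>\<not> length u \<le> p\<close> by (auto simp: ins_block_def b intro!: subseq_drop_many)
      then show False using L x(2) gt by (auto simp: adm_211_def)
    qed
  next
    assume "length u \<le> p"
    have "adm_211 s (drop (length u) ?w)"
      unfolding adm_211_def
    proof (intro allI impI notI)
      fix y z assume yz: "y < z" "subseq [z,y,y] (drop (length u) ?w)"
      then have "y \<in> insert i (set v)"
        using subseq_imp_set_subset[OF yz(2)] a by (auto simp: ins_block_def split: if_splits)
      then have "i \<le> y" using gt by (auto intro: less_imp_le)
      then have "z \<noteq> i" using yz(1) by simp
      then have "subseq [z,y,y] v"
        using yz(2) subseq_replicate_append[OF \<open>z \<noteq> i\<close>] by (simp add: ins_block_def)
      then show False using assms(2) yz(1) by (auto simp: adm_211_def)
    qed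
    then show "adm_211 s (drop p ?w)" using adm_drop \<open>length u \<le> p\<close> by blast
  qed
  then have "gaps adm_211 ?w = {length u..length ?w}" by (auto simp: gaps_def)
  then show ?thesis by (simp add: ins_block_def)
qed

text \<open>If \<open>v\<close> has a first letter \<open>x\<close>, then \<open>i x i\<close> lies
  to the right of every gap before the first \<open>i\<close>, and all later gaps are admissible. If
  \<open>v\<close> is empty, the copies of \<open>i\<close> end the word and add \<open>a\<close>
  gaps to those of \<open>u\<close>.\<close>

lemma card_gaps_ins_split_121:
  assumes gt: "\<forall>x\<in>set (u @ v). i < x" and "adm_121 u v" and a: "a \<ge> 2"
  shows "card (gaps adm_121 (ins_split i a u v)) =
    (if v = [] then a + card (gaps adm_121 u) else a + length v)"
proof -
  let ?w = "ins_split i a u v"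
  obtain b where b: "a - 1 = Suc b" "a = Suc (Suc b)" using a by (metis Suc_le_D numeral_2_eq_2 Suc_le_mono diff_Suc_1)
  have ni: "i \<notin> set u" "i \<notin> set v" using gt by auto
  \<comment> \<open>A final \<open>i\<close> cannot take part in a 121: as the first 1 it would need
    a larger letter behind it, as the 2 smaller letters around it, and as the last 1 another
    \<open>i\<close> before a larger letter.\<close>
  have tail: "adm_121 s (t @ replicate n i) \<longleftrightarrow> adm_121 s' t" if "\<forall>x\<in>set t. i < x" for s s' t n
  proof -
    have nt: "i \<notin> set t" using that by auto
    have "subseq [y,z,y] (t @ replicate n i) \<longleftrightarrow> subseq [y,z,y] t" if "y < z" for y z
    proof
      assume L: "subseq [y,z,y] (t @ replicate n i)"
      have "subseq [y,z] [y,z,y]" by simp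
      then have "subseq [y,z] (t @ replicate n i)" using L subseq_order.trans by blast
      then have "y \<noteq> i" using not_subseq_append_replicate[OF nt, of z n] \<open>y < z\<close> by auto
      moreover have "z \<noteq> i"
        using subseq_imp_set_subset[OF L] \<open>\<forall>x\<in>set t. i < x\<close> \<open>y < z\<close> \<open>y \<noteq> i\<close> by (auto split: if_splits)
      ultimately show "subseq [y,z,y] t"
        using L subseq_append_replicate_iff[OF nt, of "[y,z,y]" n] by simp
    qed (rule subseq_rev_drop_many)
    then show ?thesis by (auto simp: adm_121_def)
  qed
  show ?thesis
  proof (cases "v = []")
    case True
    have w: "?w = u @ replicate a i" using True by (simp add: ins_split_def b)
    have "adm_121 (take p ?w) (drop p ?w) \<longleftrightarrow> adm_121 (take p u) (drop p u)" for p
    proof -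
      have "drop p ?w = drop p u @ replicate (a - (p - length u)) i" by (simp add: w)
      moreover have "\<forall>x\<in>set (drop p u). i < x" using gt by (auto dest: in_set_dropD)
      ultimately show ?thesis using tail by metis
    qed
    then have "gaps adm_121 ?w = {p. p \<le> length u + a \<and> adm_121 (take p u) (drop p u)}"
      by (auto simp: gaps_def w)
    \<comment> \<open>The gap \<open>length u\<close> is already a gap of \<open>u\<close>, so only
      the \<open>a\<close> later positions are new.\<close>
    also have "\<dots> = gaps adm_121 u \<union> {length u<..length u + a}"
      by (auto simp: gaps_def adm_121_def)
    finally have "card (gaps adm_121 ?w) = card (gaps adm_121 u) + card {length u<..length u + a}"
      by (simp add: card_Un_disjoint finite_gaps) (subst card_Un_disjoint, auto simp: gaps_def)
    then show ?thesis using True by simp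
  next
    case False
    then obtain x t where x: "v = x # t" by (cases v) auto
    have "adm_121 s (drop p ?w) \<longleftrightarrow> length u < p" if "p \<le> length ?w" for s p
    proof
      assume L: "adm_121 s (drop p ?w)"
      show "length u < p"
      proof (rule ccontr)
        assume "\<not> length u < p"
        then have "subseq [i,x,i] (drop p ?w)"
          using x by (auto simp: ins_split_def b intro!: subseq_drop_many)
        then show False using L x gt by (auto simp: adm_121_def)
      qed
    next
      assume "length u < p"
      have "adm_121 s (drop (Suc (length u)) ?w)"
        using tail[of v] gt assms(2) by (auto simp: ins_split_def)
      then show "adm_121 s (drop p ?w)" using adm_drop \<open>length u < p\<close> by (metis Suc_leI)
    qed
    then have "gaps adm_121 ?w = {length u<..length ?w}" by (auto simp: gaps_def)
    then show ?thesis using False by (simp add: ins_split_def b)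
  qed
qed

text \<open>Gaps up to the first \<open>i\<close> keep their status. Those after it with a letter of
  \<open>v\<close> still to come have \<open>i\<close> on the left and that letter followed by
  \<open>i\<close> on the right. From the final run on, only copies of \<open>i\<close> remain on
  the right.\<close>

lemma card_gaps_ins_split_1_21:
  assumes gt: "\<forall>x\<in>set (u @ v). i < x" and a: "a \<ge> 2"
  shows "card (gaps adm_1_21 (ins_split i a u v)) = a + card {p \<in> gaps adm_1_21 (u @ v). p \<le> length u}"
proof -
  let ?w = "ins_split i a u v"
  let ?n = "length (u @ i # v)"
  obtain b where b: "a - 1 = Suc b" "a = Suc (Suc b)" using a by (metis Suc_le_D numeral_2_eq_2 Suc_le_mono diff_Suc_1)
  have ni: "i \<notin> set u" "i \<notin> set v" using gt by auto
  have left: "adm_1_21 (take p ?w) (drop p ?w) \<longleftrightarrow> adm_1_21 (take p (u @ v)) (drop p (u @ v))"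
    if "p \<le> length u" for p
  proof -
    have "i \<notin> set (drop p u)" using ni by (auto dest: in_set_dropD)
    then have fil: "filter (\<lambda>x. x \<noteq> i) (drop p ?w) = drop p (u @ v)"
      using that ni by (simp add: ins_split_def filter_eq_same)
    have "i \<notin> set [z,y]" if "y \<in> set (take p u)" "y < z" for y z
    proof -
      have "i < y" using that(1) gt by (auto dest: in_set_takeD)
      then show ?thesis using that(2) by simp
    qed
    then have "subseq [z,y] (drop p ?w) \<longleftrightarrow> subseq [z,y] (drop p (u @ v))"
      if "y \<in> set (take p u)" "y < z" for y z
      using that by (intro subseq_other_iff[OF fil])
    moreover have "take p ?w = take p u" "take p (u @ v) = take p u"
      using that by (auto simp: ins_split_def)
    ultimately show ?thesis by (auto simp: adm_1_21_def)
  qed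
  have middle: "\<not> adm_1_21 (take p ?w) (drop p ?w)" if p: "length u < p" "p < ?n" for p
  proof -
    \<comment> \<open>\<open>q\<close> indexes the letter of \<open>v\<close> right after the gap;
      the \<open>Suc\<close> accounts for the inserted \<open>i\<close>.\<close>
    obtain q where q: "p = length u + Suc q" "q < length v"
      using p less_imp_Suc_add by fastforce
    then have "drop q v = v ! q # drop (Suc q) v" by (simp add: Cons_nth_drop_Suc)
    then have "subseq [v ! q, i] (drop p ?w)"
      using q by (auto simp: ins_split_def b subseq_singleton_left)
    moreover have "i \<in> set (take p ?w)" using q by (simp add: ins_split_def)
    moreover have "i < v ! q" using q gt by simp
    ultimately show ?thesis by (auto simp: adm_1_21_def)
  qed
  have right: "adm_1_21 (take p ?w) (drop p ?w)" if "?n \<le> p" for p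
  proof -
    have "?w = (u @ i # v) @ replicate (Suc b) i" by (simp add: ins_split_def b)
    then have "drop p ?w = replicate (Suc b - (p - ?n)) i"
      using that by (simp only: drop_append[of p "u @ i # v" "replicate (Suc b) i"] drop_all drop_replicate append_Nil)
    then have "set (drop p ?w) \<subseteq> {i}" by auto
    then have "\<not> subseq [z,y] (drop p ?w)" if "y < z" for y z
      using that subseq_imp_set_subset[of "[z,y]" "drop p ?w"] by auto
    then show ?thesis by (simp add: adm_1_21_def)
  qed
  have len: "length ?w = ?n + Suc b" by (simp add: ins_split_def b)
  \<comment> \<open>Both ends of the final run count, so the interval has
    \<open>Suc b + 1 = a\<close> elements.\<close>
  have "gaps adm_1_21 ?w = {p \<in> gaps adm_1_21 (u @ v). p \<le> length u} \<union> {?n..?n + Suc b}"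
  proof (intro set_eqI)
    fix p
    consider "p \<le> length u" | "length u < p" "p < ?n" | "?n \<le> p" by linarith
    then show "p \<in> gaps adm_1_21 ?w \<longleftrightarrow> p \<in> {p \<in> gaps adm_1_21 (u @ v). p \<le> length u} \<union> {?n..?n + Suc b}"
    proof cases
      case 1
      then show ?thesis using left[OF 1] len by (auto simp: gaps_def)
    next
      case 2
      then show ?thesis using middle[OF 2] by (simp add: gaps_def)
    next
      case 3
      then show ?thesis using right[OF 3] len by (auto simp: gaps_def)
    qed
  qed
  moreover have "card ({p \<in> gaps adm_1_21 (u @ v). p \<le> length u} \<union> {?n..?n + Suc b}) =
      card {p \<in> gaps adm_1_21 (u @ v). p \<le> length u} + card {?n..?n + Suc b}"
    by (intro card_Un_disjoint) (auto simp: finite_gaps)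
  ultimately show ?thesis by (simp add: b)
qed

section \<open>The succession rules of the three families\<close>

interpretation block_1322: insertion_scheme good_121_1322 adm_211 ins_block
proof
  show "good_121_1322 []" "adm_211 [] []" by (auto simp: good_121_1322_def adm_211_def)
next
  fix a i :: nat and u v :: "nat list" assume "a \<ge> 1"
  then show "mset (ins_block i a u v) = mset (u @ v) + replicate_mset a i"
    by (simp add: ins_block_def)
next
  fix w :: "nat list" and i assume "good_121_1322 w" "i \<in> set w" "\<forall>x\<in>set w. i \<le> x"
  then show "\<exists>a u v. a \<ge> 1 \<and> i \<notin> set (u @ v) \<and> w = ins_block i a u v"
    by (intro ins_block_exhaust) (auto simp: good_121_1322_def)
next
  fix u v :: "nat list" and i assume "\<forall>x\<in>set (u @ v). i < x" "adm_211 u v"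
  then show "card (gaps adm_211 (ins_block i 1 u v)) = card (gaps adm_211 (u @ v)) + 1"
    using card_gaps_insert_single[of u adm_211 i v] adm_insert_single(1)[of u v i]
    by (simp add: ins_block_def) (simp add: adm_211_def)
next
  fix a i :: nat and w :: "nat list"
  assume a: "a \<ge> 2" and w: "\<forall>x\<in>set w. i < x"
  \<comment> \<open>The count decreases strictly in \<open>p\<close>, hence is injective, and
    \<open>gaps_upward\<close> keeps it within the interval.\<close>
  have *: "card (gaps adm_211 (ins_block i a (take p w) (drop p w))) = a + (length w - p) + 1"
    if "p \<in> gaps adm_211 w" for p
    using card_gaps_ins_block[of "take p w" "drop p w" i a] that a w by (simp add: gaps_def)
  show "bij_betw (\<lambda>p. card (gaps adm_211 (ins_block i a (take p w) (drop p w)))) (gaps adm_211 w)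
    {a<..a + card (gaps adm_211 w)}"
  proof (intro bij_betw_card_interval finite_gaps inj_onI)
    fix p q assume "p \<in> gaps adm_211 w" "q \<in> gaps adm_211 w"
      "card (gaps adm_211 (ins_block i a (take p w) (drop p w))) = card (gaps adm_211 (ins_block i a (take q w) (drop q w)))"
    then show "p = q" using *[of p] *[of q] by (auto simp: gaps_def)
  next
    fix p assume p: "p \<in> gaps adm_211 w"
    show "a < card (gaps adm_211 (ins_block i a (take p w) (drop p w))) \<and>
      card (gaps adm_211 (ins_block i a (take p w) (drop p w))) \<le> a + card (gaps adm_211 w)"
      using *[OF p] gaps_upward[OF p] by simp
  qed
qed (simp_all add: takeWhile_ins_block filter_ins_block good_ins_block del: set_append)

interpretation split_1232: insertion_scheme good_112_1232 adm_121 ins_split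
proof
  show "good_112_1232 []" "adm_121 [] []" by (auto simp: good_112_1232_def adm_121_def)
next
  fix w :: "nat list" and i assume "good_112_1232 w" "i \<in> set w" "\<forall>x\<in>set w. i \<le> x"
  then show "\<exists>a u v. a \<ge> 1 \<and> i \<notin> set (u @ v) \<and> w = ins_split i a u v"
    by (intro ins_split_exhaust) (auto simp: good_112_1232_def)
next
  fix u v :: "nat list" and i assume "\<forall>x\<in>set (u @ v). i < x" "adm_121 u v"
  then show "card (gaps adm_121 (ins_split i 1 u v)) = card (gaps adm_121 (u @ v)) + 1"
    using card_gaps_insert_single[of u adm_121 i v] adm_insert_single(2)[of u v i]
    by (simp add: ins_split_def) (simp add: adm_121_def)
next
  fix a i :: nat and w :: "nat list"
  assume a: "a \<ge> 2" and w: "\<forall>x\<in>set w. i < x"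
  \<comment> \<open>The last gap gets the largest value of the interval. By
    \<open>gaps_upward\<close> all others stay below it, and they exceed \<open>a\<close> because
    \<open>p < length w\<close>.\<close>
  have *: "card (gaps adm_121 (ins_split i a (take p w) (drop p w))) =
      (if p = length w then a + card (gaps adm_121 w) else a + (length w - p))"
    if "p \<in> gaps adm_121 w" for p
    using card_gaps_ins_split_121[of "take p w" "drop p w" i a] that a w by (auto simp: gaps_def)
  show "bij_betw (\<lambda>p. card (gaps adm_121 (ins_split i a (take p w) (drop p w)))) (gaps adm_121 w)
    {a<..a + card (gaps adm_121 w)}"
  proof (intro bij_betw_card_interval finite_gaps inj_onI)
    fix p q assume pq: "p \<in> gaps adm_121 w" "q \<in> gaps adm_121 w"
      "card (gaps adm_121 (ins_split i a (take p w) (drop p w))) = card (gaps adm_121 (ins_split i a (take q w) (drop q w)))"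
    then show "p = q" using *[of p] *[of q] gaps_upward[OF pq(1)] gaps_upward[OF pq(2)]
      by (auto simp: gaps_def split: if_splits)
  next
    fix p assume p: "p \<in> gaps adm_121 w"
    then have "p \<le> length w" by (simp add: gaps_def)
    then show "a < card (gaps adm_121 (ins_split i a (take p w) (drop p w))) \<and>
      card (gaps adm_121 (ins_split i a (take p w) (drop p w))) \<le> a + card (gaps adm_121 w)"
      using *[OF p] gaps_upward[OF p] by (auto split: if_splits)
  qed
qed (simp_all add: takeWhile_ins_split filter_ins_split good_ins_split_1232 mset_ins_split del: set_append mset_append)

interpretation split_2132: insertion_scheme good_112_2132 adm_1_21 ins_split
proof
  show "good_112_2132 []" "adm_1_21 [] []" by (auto simp: good_112_2132_def adm_1_21_def)
next
  fix w :: "nat list" and i assume "good_112_2132 w" "i \<in> set w" "\<forall>x\<in>set w. i \<le> x"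
  then show "\<exists>a u v. a \<ge> 1 \<and> i \<notin> set (u @ v) \<and> w = ins_split i a u v"
    by (intro ins_split_exhaust) (auto simp: good_112_2132_def)
next
  fix u v :: "nat list" and i assume "\<forall>x\<in>set (u @ v). i < x" "adm_1_21 u v"
  then show "card (gaps adm_1_21 (ins_split i 1 u v)) = card (gaps adm_1_21 (u @ v)) + 1"
    using card_gaps_insert_single[of u adm_1_21 i v] adm_insert_single(3,4)[of u v i]
    by (simp add: ins_split_def)
next
  fix a i :: nat and w :: "nat list"
  assume a: "a \<ge> 2" and w: "\<forall>x\<in>set w. i < x"
  let ?G = "gaps adm_1_21 w"
  \<comment> \<open>The count is \<open>a\<close> plus the rank of \<open>p\<close> among the
    admissible gaps, so the values \<open>a + 1, a + 2, ...\<close> appear in order.\<close>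
  have *: "card (gaps adm_1_21 (ins_split i a (take p w) (drop p w))) = a + card {q \<in> ?G. q \<le> p}"
    if "p \<in> ?G" for p
  proof -
    have "length (take p w) = p" using that by (simp add: gaps_def)
    then show ?thesis using card_gaps_ins_split_1_21[of "take p w" "drop p w" i a] a w by simp
  qed
  have less: "card {r \<in> ?G. r \<le> p} < card {r \<in> ?G. r \<le> q}" if "q \<in> ?G" "p < q" for p q
  proof (intro psubset_card_mono psubsetI)
    have "q \<in> {r \<in> ?G. r \<le> q} - {r \<in> ?G. r \<le> p}" using that by simp
    then show "{r \<in> ?G. r \<le> p} \<noteq> {r \<in> ?G. r \<le> q}" by blast
  qed (use that in \<open>auto simp: finite_gaps\<close>)
  show "bij_betw (\<lambda>p. card (gaps adm_1_21 (ins_split i a (take p w) (drop p w)))) ?G {a<..a + card ?G}"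
  proof (intro bij_betw_card_interval finite_gaps inj_onI)
    fix p q assume "p \<in> ?G" "q \<in> ?G"
      "card (gaps adm_1_21 (ins_split i a (take p w) (drop p w))) = card (gaps adm_1_21 (ins_split i a (take q w) (drop q w)))"
    then show "p = q" using *[of p] *[of q] less[of p q] less[of q p] by (cases p q rule: linorder_cases) auto
  next
    fix p assume p: "p \<in> ?G"
    have "card {q \<in> ?G. q \<le> p} \<le> card ?G" by (intro card_mono finite_gaps) auto
    moreover have "card {q \<in> ?G. q \<le> p} > 0" using p by (auto simp: card_gt_0_iff finite_gaps)
    ultimately show "a < card (gaps adm_1_21 (ins_split i a (take p w) (drop p w))) \<and>
      card (gaps adm_1_21 (ins_split i a (take p w) (drop p w))) \<le> a + card ?G"
      using *[OF p] by simp
  qed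
qed (simp_all add: takeWhile_ins_split filter_ins_split good_ins_split_2132 mset_ins_split del: set_append mset_append)

text \<open>Each \<open>good\<close> predicate is avoidance of its pattern pair, so
  \<open>card_words\<close> of the three schemes yields the common value \<open>N S\<close>.\<close>

lemma av_eq_tree_sum:
  defines "N \<equiv> \<lambda>S. tree_sum (map (count S) (sorted_list_of_set (set_mset S))) (\<lambda>_. 1)"
  shows "av S {[1,2,1], [1,3,2,2]} = N S"
    and "av S {[1,1,2], [1,2,3,2]} = N S"
    and "av S {[1,1,2], [2,1,3,2]} = N S"
proof -
  have "(\<forall>\<rho>\<in>{[1,2,1], [1,3,2,2]}. avoids w \<rho>) \<longleftrightarrow> good_121_1322 w" for w
    unfolding good_121_1322_def ball_simps avoids_121 avoids_1322 by blast
  then show "av S {[1,2,1], [1,3,2,2]} = N S"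
    unfolding av_def N_def by (simp only: block_1322.card_words[symmetric] block_1322.words_def)
  have "(\<forall>\<rho>\<in>{[1,1,2], [1,2,3,2]}. avoids w \<rho>) \<longleftrightarrow> good_112_1232 w" for w
    unfolding good_112_1232_def ball_simps avoids_112 avoids_1232 by blast
  then show "av S {[1,1,2], [1,2,3,2]} = N S"
    unfolding av_def N_def by (simp only: split_1232.card_words[symmetric] split_1232.words_def)
  have "(\<forall>\<rho>\<in>{[1,1,2], [2,1,3,2]}. avoids w \<rho>) \<longleftrightarrow> good_112_2132 w" for w
    unfolding good_112_2132_def ball_simps avoids_112 avoids_2132 by blast
  then show "av S {[1,1,2], [2,1,3,2]} = N S"
    unfolding av_def N_def by (simp only: split_2132.card_words[symmetric] split_2132.words_def)
qed

theorem theorem2p15: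
  "m_equivalent {[1,2,1], [1,3,2,2]} {[1,1,2], [1,2,3,2]} \<and>
   m_equivalent {[1,1,2], [1,2,3,2]} {[1,1,2], [2,1,3,2]} \<and>
   m_equivalent {[1,2,1], [1,3,2,2]} {[1,1,2], [2,1,3,2]}"
  unfolding m_equivalent_def av_eq_tree_sum by blast

end
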